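(* Let $H$ be a group which is generated by a finite set $S \subseteq H$ and which is virtually free (i.e. has a free subgroup of finite index). Let $d_{\Gamma}$ be the metric on $H$ obtained from the Cayley graph $\Gamma = \Gamma(H, S)$. Then the abelian group $\mathbb{Z}[1/2]$ of dyadic rationals (under addition) is not isomorphic to a subgroup of $\mathfrak{B}\mathfrak{d}(H, d_{\Gamma})$.
   Context: For a set $X$, $\operatorname{Sym}(X)$ is the group of all bijections of $X$, acting on the right (the image of $x$ under $g$ is written $xg$). For a metric space $(X,d)$, $$\mathfrak{B}\mathfrak{d}(X, d) = \{g \in \operatorname{Sym}(X) \mid (\exists r_g \in \mathbb{Z}^+)(\forall x \in X)\ d(x, xg) \leq r_g\}$$ is the subgroup of $\operatorname{Sym}(X)$ of bounded displacement permutations, where $\mathbb{Z}^+$ denotes the positive integers. The metric $d_\Gamma$ on $H$ is the restriction to the vertex set $H$ of the path metric (edges of length $1$) on the Cayley graph $\Gamma(H,S)$, i.e. the word metric with respect to $S$. Free groups of any rank, including the trivial group (rank $0$), are allowed as the finite-index free subgroup. *)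

theory Defs
  imports
    "HOL-Algebra.Generated_Groups"
    "HOL-Algebra.Coset"
    "HOL-Algebra.Bij"
    "HOL-Analysis.Abstract_Metric_Spaces"
begin

section \<open>Free and virtually free groups\<close>

text \<open>
  A letter \<open>(b, e)\<close> stands for \<open>b\<close> if \<open>e\<close> holds and for the inverse of \<open>b\<close> otherwise.
\<close>

type_synonym 'b word = "('b \<times> bool) list"

fun reduced :: "'b word \<Rightarrow> bool" where
  "reduced [] = True"
| "reduced [x] = True"
| "reduced (x # y # w) = (\<not> (fst x = fst y \<and> snd x \<noteq> snd y) \<and> reduced (y # w))"

definition reduced_words :: "'b set \<Rightarrow> 'b word set" where
  "reduced_words B = {w. fst ` set w \<subseteq> B \<and> reduced w}"

definition letter_val :: "('a, 'c) monoid_scheme \<Rightarrow> ('b \<Rightarrow> 'a) \<Rightarrow> 'b \<times> bool \<Rightarrow> 'a" where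
  "letter_val G f x = (if snd x then f (fst x) else inv\<^bsub>G\<^esub> (f (fst x)))"

definition word_val :: "('a, 'c) monoid_scheme \<Rightarrow> ('b \<Rightarrow> 'a) \<Rightarrow> 'b word \<Rightarrow> 'a" where
  "word_val G f w = foldr (\<lambda>x g. letter_val G f x \<otimes>\<^bsub>G\<^esub> g) w \<one>\<^bsub>G\<^esub>"

text \<open>
  \<open>B\<close> is a free basis if every element is the value of exactly one reduced word over \<open>B\<close>.
  The basis may be infinite, and it may be empty, in which case the group is trivial.
\<close>

definition free_basis :: "('a, 'c) monoid_scheme \<Rightarrow> 'a set \<Rightarrow> bool" where
  "free_basis G B \<longleftrightarrow>
     B \<subseteq> carrier G \<and> bij_betw (word_val G (\<lambda>b. b)) (reduced_words B) (carrier G)"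

definition free_group :: "('a, 'c) monoid_scheme \<Rightarrow> bool" where
  "free_group G \<longleftrightarrow> group G \<and> (\<exists>B. free_basis G B)"

definition virtually_free :: "('a, 'c) monoid_scheme \<Rightarrow> bool" where
  "virtually_free G \<longleftrightarrow>
     (\<exists>F. subgroup F G \<and> finite (rcosets\<^bsub>G\<^esub> F) \<and> free_group (G\<lparr>carrier := F\<rparr>))"

text \<open>Free bases have the universal property, with respect to groups over any type.\<close>

lemma word_val_simps [simp]:
  "word_val G f [] = \<one>\<^bsub>G\<^esub>"
  "word_val G f (x # w) = letter_val G f x \<otimes>\<^bsub>G\<^esub> word_val G f w"
  by (simp_all add: word_val_def)

lemma (in group) letter_val_closed:
  "f \<in> B \<rightarrow> carrier G \<Longrightarrow> fst x \<in> B \<Longrightarrow> letter_val G f x \<in> carrier G"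
  by (auto simp: letter_val_def)

lemma (in group) word_val_closed:
  "f \<in> B \<rightarrow> carrier G \<Longrightarrow> fst ` set w \<subseteq> B \<Longrightarrow> word_val G f w \<in> carrier G"
  by (induction w) (auto intro: letter_val_closed)

lemma (in group) word_val_append:
  assumes "f \<in> B \<rightarrow> carrier G" "fst ` set u \<subseteq> B" "fst ` set v \<subseteq> B"
  shows "word_val G f (u @ v) = word_val G f u \<otimes> word_val G f v"
  using assms(2)
proof (induction u)
  case Nil
  then show ?case using word_val_closed[OF assms(1,3)] by simp
next
  case (Cons x u)
  then show ?case
    using word_val_closed[OF assms(1,3)] word_val_closed[OF assms(1)] letter_val_closed[OF assms(1)]
    by (simp add: m_assoc)
qed

lemma reduced_tl: "reduced (x # w) \<Longrightarrow> reduced w"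
  by (cases w) auto

text \<open>The reduction does not depend on the group in which the words are evaluated.\<close>

fun reduce :: "'b word \<Rightarrow> 'b word" where
  "reduce [] = []"
| "reduce (x # w) = (case reduce w of
     [] \<Rightarrow> [x]
   | y # v \<Rightarrow> if fst x = fst y \<and> snd x \<noteq> snd y then v else x # y # v)"

lemma reduce_in_reduced_words: "fst ` set w \<subseteq> B \<Longrightarrow> reduce w \<in> reduced_words B"
proof (induction w)
  case Nil
  then show ?case by (simp add: reduced_words_def)
next
  case (Cons x w)
  then show ?case
    by (cases "reduce w") (auto simp: reduced_words_def dest: reduced_tl)
qed

lemma (in group) word_val_reduce:
  assumes "f \<in> B \<rightarrow> carrier G" "fst ` set w \<subseteq> B"
  shows "word_val G f (reduce w) = word_val G f w"
  using assms(2)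
proof (induction w)
  case Nil
  then show ?case by simp
next
  case (Cons x w)
  then have IH: "word_val G f w = word_val G f (reduce w)" and x: "fst x \<in> B" by auto
  from reduce_in_reduced_words[of w B] Cons.prems have r: "fst ` set (reduce w) \<subseteq> B"
    by (auto simp: reduced_words_def)
  show ?case
  proof (cases "reduce w")
    case Nil
    then show ?thesis using IH by simp
  next
    case (Cons y v)
    have fx: "f (fst x) \<in> carrier G" using x assms(1) by auto
    have v: "word_val G f v \<in> carrier G"
      by (rule word_val_closed[OF assms(1)]) (use r Cons in auto)
    have "letter_val G f x \<otimes> (letter_val G f y \<otimes> word_val G f v) = word_val G f v"
      if "fst x = fst y" "snd x \<noteq> snd y"
      using that fx v by (auto simp: letter_val_def m_assoc[symmetric])
    then show ?thesis using IH Cons by simp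
  qed
qed

lemma word_val_hom:
  assumes "group G" "group K" "h \<in> hom G K" "f \<in> B \<rightarrow> carrier G" "fst ` set w \<subseteq> B"
  shows "h (word_val G f w) = word_val K (h \<circ> f) w"
proof -
  interpret group_hom G K h
    using assms(1-3) by (simp add: group_hom_def group_hom_axioms_def)
  show ?thesis using assms(5)
  proof (induction w)
    case Nil
    then show ?case by simp
  next
    case (Cons x w)
    then have "f (fst x) \<in> carrier G" using assms(4) by auto
    then have "h (letter_val G f x) = letter_val K (h \<circ> f) x" by (simp add: letter_val_def)
    moreover have "letter_val G f x \<in> carrier G" "word_val G f w \<in> carrier G"
      using Cons.prems
      by (auto intro: G.letter_val_closed[OF assms(4)] G.word_val_closed[OF assms(4)])
    ultimately show ?case using Cons by (simp add: o_def)
  qed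
qed

lemma free_basis_universal:
  assumes "group G" "free_basis G B" "group K" "f \<in> B \<rightarrow> carrier K"
  shows "\<exists>h \<in> hom G K. (\<forall>b\<in>B. h b = f b) \<and>
           (\<forall>h' \<in> hom G K. (\<forall>b\<in>B. h' b = f b) \<longrightarrow> (\<forall>g\<in>carrier G. h' g = h g))"
proof -
  interpret G: group G by fact
  interpret K: group K by fact
  let ?val = "word_val G (\<lambda>b. b)"
  define nf where "nf = inv_into (reduced_words B) ?val"
  define h where "h = (\<lambda>g. word_val K f (nf g))"
  have B: "(\<lambda>b. b) \<in> B \<rightarrow> carrier G" and bij: "bij_betw ?val (reduced_words B) (carrier G)"
    using assms(2) by (auto simp: free_basis_def)
  have nf: "nf g \<in> reduced_words B" "?val (nf g) = g" if "g \<in> carrier G" for g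
    using bij that unfolding nf_def
    by (auto simp: bij_betw_def inv_into_into f_inv_into_f)
  have nf_eq: "nf (?val w) = w" if "w \<in> reduced_words B" for w
    using bij that unfolding nf_def by (simp add: bij_betw_def)
  have letters: "fst ` set (nf g) \<subseteq> B" if "g \<in> carrier G" for g
    using nf(1)[OF that] by (simp add: reduced_words_def)
  have hval: "h (?val w) = word_val K f w" if w: "fst ` set w \<subseteq> B" for w
  proof -
    have "nf (?val w) = reduce w"
      using nf_eq[OF reduce_in_reduced_words[OF w]] G.word_val_reduce[OF B w] by simp
    then show ?thesis using K.word_val_reduce[OF assms(4) w] by (simp add: h_def)
  qed
  have mult: "h (x \<otimes>\<^bsub>G\<^esub> y) = h x \<otimes>\<^bsub>K\<^esub> h y" if x: "x \<in> carrier G" and y: "y \<in> carrier G" for x y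
  proof -
    have "x \<otimes>\<^bsub>G\<^esub> y = ?val (nf x @ nf y)"
      using G.word_val_append[OF B letters[OF x] letters[OF y]] nf x y by simp
    then have "h (x \<otimes>\<^bsub>G\<^esub> y) = word_val K f (nf x @ nf y)"
      using hval[of "nf x @ nf y"] letters[OF x] letters[OF y] by auto
    then show ?thesis
      using K.word_val_append[OF assms(4) letters[OF x] letters[OF y]] by (simp add: h_def)
  qed
  have "h g \<in> carrier K" if "g \<in> carrier G" for g
    unfolding h_def by (rule K.word_val_closed[OF assms(4) letters[OF that]])
  then have hom: "h \<in> hom G K" by (auto simp: hom_def mult)
  have base: "h b = f b" if b: "b \<in> B" for b
  proof -
    have "b \<in> carrier G" "f b \<in> carrier K" using b B assms(4) by auto
    then show ?thesis using hval[of "[(b, True)]"] b by (simp add: letter_val_def)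
  qed
  have cong: "word_val K u w = word_val K v w"
    if "\<forall>b\<in>B. u b = v b" "fst ` set w \<subseteq> B" for u v and w :: "'a word"
    using that(2) by (induction w) (auto simp: letter_val_def that(1))
  have "h' g = h g"
    if h': "h' \<in> hom G K" "\<forall>b\<in>B. h' b = f b" and g: "g \<in> carrier G" for h' g
  proof -
    have "h' (?val (nf g)) = word_val K (h' \<circ> (\<lambda>b. b)) (nf g)"
      by (rule word_val_hom[OF assms(1,3) h'(1) B letters[OF g]])
    also have "\<dots> = word_val K f (nf g)"
      by (rule cong[OF _ letters[OF g]]) (use h'(2) in simp)
    finally show ?thesis using nf(2)[OF g] by (simp add: h_def)
  qed
  with hom base show ?thesis by blast
qed

section \<open>The Cayley graph and its metric\<close>

text \<open>
  Edges are undirected, joining \<open>x\<close> to \<open>x \<otimes> s\<close>.  Should \<open>\<one> \<in> S\<close>, there are loops; these do not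
  affect distances.
\<close>

definition cayley_edges :: "('a, 'c) monoid_scheme \<Rightarrow> 'a set \<Rightarrow> ('a \<times> 'a) set" where
  "cayley_edges G S = {(x, y). x \<in> carrier G \<and> y \<in> carrier G \<and>
     (\<exists>s\<in>S. y = x \<otimes>\<^bsub>G\<^esub> s \<or> x = y \<otimes>\<^bsub>G\<^esub> s)}"

text \<open>
  The least number of edges of a path; meaningful if the graph is connected, that is,
  if \<open>S\<close> generates \<open>G\<close>.
\<close>

definition cayley_dist :: "('a, 'c) monoid_scheme \<Rightarrow> 'a set \<Rightarrow> 'a \<Rightarrow> 'a \<Rightarrow> real" where
  "cayley_dist G S x y = real (LEAST n. (x, y) \<in> cayley_edges G S ^^ n)"

lemma cayley_edges_sym: "(x, y) \<in> cayley_edges G S \<Longrightarrow> (y, x) \<in> cayley_edges G S"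
  by (auto simp: cayley_edges_def)

lemma cayley_path_sym:
  "(x, y) \<in> cayley_edges G S ^^ n \<Longrightarrow> (y, x) \<in> cayley_edges G S ^^ n"
proof (induction n arbitrary: y)
  case 0
  then show ?case by simp
next
  case (Suc n)
  from Suc.prems obtain z where "(x, z) \<in> cayley_edges G S ^^ n" "(z, y) \<in> cayley_edges G S"
    by auto
  then show ?case by (blast intro: relpow_Suc_I2 cayley_edges_sym Suc.IH)
qed

lemma (in group) cayley_connected:
  assumes S: "S \<subseteq> carrier G" and gen: "generate G S = carrier G"
    and x: "x \<in> carrier G" and y: "y \<in> carrier G"
  shows "\<exists>n. (x, y) \<in> cayley_edges G S ^^ n"
proof -
  have *: "(z, z \<otimes> g) \<in> (cayley_edges G S)\<^sup>*" if "g \<in> generate G S" "z \<in> carrier G" for g z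
    using that
  proof (induction arbitrary: z rule: generate.induct)
    case one
    then show ?case by simp
  next
    case (incl s)
    then show ?case using S by (intro r_into_rtrancl) (auto simp: cayley_edges_def)
  next
    case (inv s)
    then have "s \<in> carrier G" using S by auto
    with inv have "(z, z \<otimes> inv s) \<in> cayley_edges G S"
      by (auto simp: cayley_edges_def m_assoc intro!: bexI[of _ s])
    then show ?case by simp
  next
    case (eng h1 h2)
    then have "h1 \<in> carrier G" "h2 \<in> carrier G" using gen by auto
    with eng have "(z, z \<otimes> h1) \<in> (cayley_edges G S)\<^sup>*"
      "(z \<otimes> h1, z \<otimes> h1 \<otimes> h2) \<in> (cayley_edges G S)\<^sup>*"
      by auto
    with \<open>h1 \<in> carrier G\<close> \<open>h2 \<in> carrier G\<close> eng.prems show ?case by (simp add: m_assoc)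
  qed
  have "(x, x \<otimes> (inv x \<otimes> y)) \<in> (cayley_edges G S)\<^sup>*"
    using x y gen by (intro *) auto
  moreover have "x \<otimes> (inv x \<otimes> y) = y" using x y by (simp add: m_assoc[symmetric])
  ultimately show ?thesis by (simp add: rtrancl_imp_relpow)
qed

lemma (in group) Metric_space_cayley_dist:
  assumes "S \<subseteq> carrier G" "generate G S = carrier G"
  shows "Metric_space (carrier G) (cayley_dist G S)"
proof
  let ?R = "cayley_edges G S"
  let ?d = "\<lambda>x y. LEAST n. (x, y) \<in> ?R ^^ n"
  have path: "(x, y) \<in> ?R ^^ ?d x y" if "x \<in> carrier G" "y \<in> carrier G" for x y
    using cayley_connected[OF assms that] by (rule LeastI_ex)
  fix x y z
  show "0 \<le> cayley_dist G S x y" by (simp add: cayley_dist_def)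
  have "(x, y) \<in> ?R ^^ n \<longleftrightarrow> (y, x) \<in> ?R ^^ n" for n
    by (blast intro: cayley_path_sym)
  then show "cayley_dist G S x y = cayley_dist G S y x" by (simp add: cayley_dist_def)
  assume x: "x \<in> carrier G" and y: "y \<in> carrier G"
  show "cayley_dist G S x y = 0 \<longleftrightarrow> x = y"
  proof
    assume "cayley_dist G S x y = 0"
    then show "x = y" using path[OF x y] by (simp add: cayley_dist_def)
  next
    assume "x = y"
    then have "?d x y = 0" by (intro Least_eq_0) simp
    then show "cayley_dist G S x y = 0" by (simp add: cayley_dist_def)
  qed
  assume z: "z \<in> carrier G"
  have "(x, z) \<in> ?R ^^ (?d x y + ?d y z)"
    using path[OF x y] path[OF y z] by (auto simp: relpow_add)
  then have "?d x z \<le> ?d x y + ?d y z" by (rule Least_le)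
  then show "cayley_dist G S x z \<le> cayley_dist G S x y + cayley_dist G S y z"
    unfolding cayley_dist_def of_nat_add[symmetric] of_nat_le_iff .
qed

section \<open>Bounded displacement permutations\<close>

text \<open>
  Permutations act on the right, so in a product \<open>g \<otimes> h\<close> the left factor is applied first.
  The library's \<^const>\<open>BijGroup\<close> composes in the opposite order.
\<close>

definition Sym :: "'a set \<Rightarrow> ('a \<Rightarrow> 'a) monoid" where
  "Sym X = (BijGroup X)\<lparr>mult := \<lambda>g h. h \<otimes>\<^bsub>BijGroup X\<^esub> g\<rparr>"

definition bd_perms :: "'a set \<Rightarrow> ('a \<Rightarrow> 'a \<Rightarrow> real) \<Rightarrow> ('a \<Rightarrow> 'a) set" where
  "bd_perms X d = {g \<in> carrier (Sym X). \<exists>r::nat. r > 0 \<and> (\<forall>x\<in>X. d x (g x) \<le> real r)}"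

definition Bd :: "'a set \<Rightarrow> ('a \<Rightarrow> 'a \<Rightarrow> real) \<Rightarrow> ('a \<Rightarrow> 'a) monoid" where
  "Bd X d = (Sym X)\<lparr>carrier := bd_perms X d\<rparr>"

lemma carrier_Sym [simp]: "carrier (Sym X) = Bij X"
  by (simp add: Sym_def BijGroup_def)

lemma one_Sym [simp]: "\<one>\<^bsub>Sym X\<^esub> = (\<lambda>x\<in>X. x)"
  by (simp add: Sym_def BijGroup_def)

lemma mult_Sym [simp]: "g \<in> Bij X \<Longrightarrow> h \<in> Bij X \<Longrightarrow> g \<otimes>\<^bsub>Sym X\<^esub> h = compose X h g"
  by (simp add: Sym_def BijGroup_def)

lemma group_Sym: "group (Sym X)"
proof (rule groupI)
  interpret B: group "BijGroup X" by (rule group_BijGroup)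
  have c: "carrier (Sym X) = carrier (BijGroup X)" by (simp add: BijGroup_def)
  have m: "x \<otimes>\<^bsub>Sym X\<^esub> y = y \<otimes>\<^bsub>BijGroup X\<^esub> x" for x y by (simp add: Sym_def)
  have o: "\<one>\<^bsub>Sym X\<^esub> = \<one>\<^bsub>BijGroup X\<^esub>" by (simp add: Sym_def)
  show "\<one>\<^bsub>Sym X\<^esub> \<in> carrier (Sym X)" unfolding c o by simp
  fix x y z assume "x \<in> carrier (Sym X)"
  then have x: "x \<in> carrier (BijGroup X)" unfolding c .
  show "\<one>\<^bsub>Sym X\<^esub> \<otimes>\<^bsub>Sym X\<^esub> x = x" unfolding m o using x by simp
  show "\<exists>y\<in>carrier (Sym X). y \<otimes>\<^bsub>Sym X\<^esub> x = \<one>\<^bsub>Sym X\<^esub>"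
    unfolding m o c using x by (blast intro: B.r_inv B.inv_closed)
  assume "y \<in> carrier (Sym X)"
  then have y: "y \<in> carrier (BijGroup X)" unfolding c .
  show "x \<otimes>\<^bsub>Sym X\<^esub> y \<in> carrier (Sym X)" unfolding m c using x y by simp
  assume "z \<in> carrier (Sym X)"
  then have z: "z \<in> carrier (BijGroup X)" unfolding c .
  show "x \<otimes>\<^bsub>Sym X\<^esub> y \<otimes>\<^bsub>Sym X\<^esub> z = x \<otimes>\<^bsub>Sym X\<^esub> (y \<otimes>\<^bsub>Sym X\<^esub> z)"
    unfolding m using x y z by (simp add: B.m_assoc)
qed

lemma subgroup_bd_perms:
  assumes "Metric_space X d"
  shows "subgroup (bd_perms X d) (Sym X)"
proof -
  interpret Metric_space X d by fact
  interpret S: group "Sym X" by (rule group_Sym)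
  have in_X: "g x \<in> X" if "g \<in> Bij X" "x \<in> X" for g x
    using Bij_imp_funcset[OF that(1)] that(2) by auto
  show ?thesis
  proof (rule S.subgroupI)
    show "bd_perms X d \<subseteq> carrier (Sym X)" by (auto simp: bd_perms_def)
    have "(\<lambda>x\<in>X. x) \<in> bd_perms X d"
      by (auto simp: bd_perms_def id_Bij intro!: exI[of _ 1])
    then show "bd_perms X d \<noteq> {}" by blast
  next
    fix g assume "g \<in> bd_perms X d"
    then obtain r :: nat where g: "g \<in> Bij X" and r: "r > 0" "\<forall>x\<in>X. d x (g x) \<le> real r"
      by (auto simp: bd_perms_def)
    let ?i = "inv\<^bsub>Sym X\<^esub> g"
    have i: "?i \<in> Bij X" using S.inv_closed[of g] g by simp
    have "d x (?i x) \<le> real r" if x: "x \<in> X" for x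
    proof -
      have "compose X g ?i = (\<lambda>x\<in>X. x)" using S.l_inv[of g] g i by simp
      then have "g (?i x) = x" using x by (metis compose_eq restrict_apply')
      then show ?thesis using r(2) in_X[OF i x] commute by metis
    qed
    then show "?i \<in> bd_perms X d" using i r(1) by (auto simp: bd_perms_def)
  next
    fix g h assume "g \<in> bd_perms X d" "h \<in> bd_perms X d"
    then obtain r s :: nat where g: "g \<in> Bij X" and r: "r > 0" "\<forall>x\<in>X. d x (g x) \<le> real r"
      and h: "h \<in> Bij X" and s: "s > 0" "\<forall>x\<in>X. d x (h x) \<le> real s"
      by (auto simp: bd_perms_def)
    have "d x (h (g x)) \<le> real (r + s)" if x: "x \<in> X" for x
    proof -
      have gx: "g x \<in> X" and hgx: "h (g x) \<in> X" using in_X g h x by auto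
      have "d x (g x) \<le> real r" "d (g x) (h (g x)) \<le> real s" using r(2) s(2) x gx by auto
      then show ?thesis using triangle[OF x gx hgx] by simp
    qed
    then show "g \<otimes>\<^bsub>Sym X\<^esub> h \<in> bd_perms X d"
      using g h r(1) by (auto simp: bd_perms_def compose_Bij compose_eq intro!: exI[of _ "r + s"])
  qed
qed

lemma group_Bd: "Metric_space X d \<Longrightarrow> group (Bd X d)"
  unfolding Bd_def by (rule subgroup.subgroup_is_group[OF subgroup_bd_perms group_Sym])

section \<open>The dyadic rationals\<close>

definition dyadic_group :: "rat monoid" where
  "dyadic_group =
     \<lparr>carrier = {x. \<exists>(m::int) (n::nat). x = of_int m / 2 ^ n}, mult = (+), one = 0\<rparr>"

end

theory Submission
  imports Defs "HOL-Library.Sublist"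
begin

text \<open>
  The free subgroup of finite index makes the group look like a tree: write
  each \<open>x\<close> as an element of the free subgroup times a coset representative, and label \<open>x\<close> by the
  reduced word of the first factor.  Labels have a finite alphabet, each label occurs boundedly
  often, and adjacent vertices of the Cayley graph have labels that differ only in a suffix of
  bounded length (\<open>virtually_free_labelling\<close>).  For a word \<open>w\<close> consider the cut of the group into
  the elements whose label begins with \<open>w\<close> and the others.  A permutation \<open>g\<close> of bounded
  displacement moves only boundedly many elements across such a cut, and the bound \<open>Q\<close> depends on
  the displacement of \<open>g\<close> but not on \<open>w\<close> (\<open>crossings_le_collar_bound\<close>).

  Suppose that \<open>g = h^N\<close> with \<open>N > Q\<close>, where \<open>h\<close> has bounded displacement as well, by however
  large a bound.  If an orbit of \<open>h\<close> has many points on both sides of a cut, then, as \<open>h\<close> crosses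
  the cut boundedly often, the orbit contains \<open>N\<close> consecutive points on one side and \<open>N\<close>
  consecutive points on the other.  On the way from one run to the other, each of the \<open>N\<close> residue
  classes modulo \<open>N\<close> is a sequence of steps of \<open>g\<close> and has to cross the cut, so that \<open>g\<close> crosses
  it at least \<open>N > Q\<close> times, which is impossible.  Hence every cut has at most \<open>M\<close> points of each
  orbit of \<open>h\<close> on one of its sides, with \<open>M\<close> the same for all cuts and orbits
  (\<open>lopsided_cut\<close>).

  In a tree of bounded degree this bounds the size of orbits: starting at the empty word, one could
  descend forever into the child that contains all but \<open>M\<close> points of the orbit
  (\<open>segment_bounded\<close>).  So \<open>h\<close> has finite order (\<open>root_has_finite_order\<close>).  In a copy of the
  dyadic rationals take for \<open>g\<close> the image of \<open>1\<close> and for \<open>h\<close> the image of \<open>1 / 2^n\<close> with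
  \<open>2^n > Q\<close>; this \<open>h\<close> would have infinite order.
\<close>

section \<open>Cutting a path\<close>

text \<open>
  A set of positions on a path is a union of runs, and all runs but the last one end in an exit; if
  the set is large compared to the number of exits, one of the runs is long.  In the proof, a
  position at which no run of length \<open>N\<close> starts lies less than \<open>N\<close> before an exit or less than
  \<open>N\<close> before the end of the path.
\<close>

lemma long_run:
  fixes P :: "nat \<Rightarrow> bool"
  assumes exits: "card {j. Suc j < m \<and> P j \<and> \<not> P (Suc j)} \<le> R"
    and many: "(R + 1) * N < card {j. j < m \<and> P j}"
  obtains i where "i + N \<le> m" and "\<And>j. i \<le> j \<Longrightarrow> j < i + N \<Longrightarrow> P j"
proof -
  let ?E = "{j. Suc j < m \<and> P j \<and> \<not> P (Suc j)}"
  have "\<exists>i. i + N \<le> m \<and> (\<forall>j. i \<le> j \<and> j < i + N \<longrightarrow> P j)"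
  proof (rule ccontr)
    assume no: "\<not> ?thesis"
    have "{j. j < m \<and> P j} \<subseteq> (\<Union>e\<in>?E. {Suc e - N..e}) \<union> {m - N..<m}"
    proof
      fix i assume "i \<in> {j. j < m \<and> P j}"
      then have i: "i < m" "P i" by auto
      show "i \<in> (\<Union>e\<in>?E. {Suc e - N..e}) \<union> {m - N..<m}"
      proof (cases "i + N \<le> m")
        case True
        with no obtain j0 where j0: "i \<le> j0 \<and> j0 < i + N \<and> \<not> P j0" by blast
        define j where "j = (LEAST j. i \<le> j \<and> j < i + N \<and> \<not> P j)"
        have j: "i \<le> j \<and> j < i + N \<and> \<not> P j"
          unfolding j_def by (rule LeastI[of _ j0]) (rule j0)
        have "j \<noteq> i" using j i by auto
        then obtain e where e: "j = Suc e" "i \<le> e" using j by (cases j) auto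
        have "P e"
          using not_less_Least[of e "\<lambda>j. i \<le> j \<and> j < i + N \<and> \<not> P j"] e j
          unfolding j_def[symmetric] by auto
        then have "e \<in> ?E" "i \<in> {Suc e - N..e}" using e j True by auto
        then show ?thesis by blast
      next
        case False
        then show ?thesis using i by auto
      qed
    qed
    moreover have fin: "finite ?E" by (rule finite_subset[of _ "{..<m}"]) auto
    ultimately have "card {j. j < m \<and> P j} \<le> card ((\<Union>e\<in>?E. {Suc e - N..e}) \<union> {m - N..<m})"
      by (intro card_mono) auto
    also have "\<dots> \<le> card (\<Union>e\<in>?E. {Suc e - N..e}) + card {m - N..<m}"
      by (rule card_Un_le)
    finally have total: "card {j. j < m \<and> P j} \<le> card (\<Union>e\<in>?E. {Suc e - N..e}) + N" by simp
    have "card (\<Union>e\<in>?E. {Suc e - N..e}) \<le> (\<Sum>e\<in>?E. card {Suc e - N..e})"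
      by (rule card_UN_le[OF fin])
    also have "\<dots> \<le> card ?E * N"
      using sum_bounded_above[of ?E "\<lambda>e. card {Suc e - N..e}" N] by simp
    also have "\<dots> \<le> R * N" using exits by (rule mult_le_mono1)
    finally show False using total many by (simp add: algebra_simps)
  qed
  then show thesis using that by blast
qed

text \<open>
  Each residue class modulo \<open>N\<close> meets both windows, so it leaves \<open>P\<close> somewhere in between in a
  step of length \<open>N\<close>.
\<close>

lemma many_crossings:
  fixes P :: "nat \<Rightarrow> bool"
  assumes "\<And>j. i \<le> j \<Longrightarrow> j < i + N \<Longrightarrow> P j"
    and "\<And>j. k \<le> j \<Longrightarrow> j < k + N \<Longrightarrow> \<not> P j"
    and "i \<le> k" and "k + N \<le> m"
  shows "N \<le> card {j. j + N < m \<and> P j \<and> \<not> P (j + N)}"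
proof -
  let ?J = "{j. j + N < m \<and> P j \<and> \<not> P (j + N)}"
  have "a \<in> (\<lambda>j. (j - i) mod N) ` ?J" if a: "a < N" for a
  proof -
    have N: "N > 0" using a by simp
    have ik: "i + N \<le> k"
    proof (rule ccontr)
      assume "\<not> i + N \<le> k"
      then show False using assms(1)[of k] assms(2)[of k] assms(3) N by auto
    qed
    \<comment> \<open>\<open>i + a + q0 * N\<close> is the point of the residue class of \<open>i + a\<close> in the second window.\<close>
    define d where "d = k + N - 1 - i - a"
    define q0 where "q0 = d div N"
    have d: "i + a + d = k + N - 1" using ik a by (simp add: d_def)
    have q0N: "d = q0 * N + d mod N" "d mod N < N" using N by (simp_all add: q0_def)
    have q0: "k \<le> i + a + q0 * N" "i + a + q0 * N < k + N" using q0N d N by arith+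
    define q where "q = (LEAST q. \<not> P (i + a + q * N))"
    have q: "\<not> P (i + a + q * N)" "q \<le> q0"
      unfolding q_def using assms(2)[OF q0]
      by (rule LeastI[of "\<lambda>q. \<not> P (i + a + q * N)"],
          rule Least_le[of "\<lambda>q. \<not> P (i + a + q * N)"])
    have "P (i + a)" using a by (intro assms(1)) auto
    then have "q \<noteq> 0" using q(1) by (intro notI) simp
    then obtain p where p: "q = Suc p" by (cases q) auto
    have "P (i + a + p * N)"
      using not_less_Least[of p "\<lambda>q. \<not> P (i + a + q * N)"] p unfolding q_def[symmetric] by auto
    moreover have "q * N \<le> q0 * N" using q(2) by simp
    then have "i + a + p * N + N < m" using q0(2) assms(4) unfolding p by simp
    ultimately have "i + a + p * N \<in> ?J" using q(1) p by (simp add: algebra_simps)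
    then show ?thesis using a by (intro image_eqI[of _ _ "i + a + p * N"]) auto
  qed
  then have "{..<N} \<subseteq> (\<lambda>j. (j - i) mod N) ` ?J" by auto
  moreover have fin: "finite ?J" by (rule finite_subset[of _ "{..<m}"]) auto
  ultimately have "card {..<N} \<le> card ((\<lambda>j. (j - i) mod N) ` ?J)" by (intro card_mono) auto
  also have "\<dots> \<le> card ?J" by (rule card_image_le[OF fin])
  finally show ?thesis by simp
qed

text \<open>
  The path is a segment of an \<open>h\<close>-orbit and \<open>P\<close> one side of a cut.  The number \<open>R\<close> of crossings
  by \<open>h\<close> may be large compared to \<open>N\<close>; it is only the crossings by \<open>h^N\<close> that have to be fewer
  than \<open>N\<close>.
\<close>

lemma lopsided_cut:
  fixes P :: "nat \<Rightarrow> bool"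
  assumes "card {j. Suc j < m \<and> P j \<and> \<not> P (Suc j)} \<le> R"
    and "card {j. Suc j < m \<and> \<not> P j \<and> P (Suc j)} \<le> R"
    and "card {j. j + N < m \<and> P j \<and> \<not> P (j + N)} < N"
    and "card {j. j + N < m \<and> \<not> P j \<and> P (j + N)} < N"
  shows "card {j. j < m \<and> P j} \<le> (R + 1) * N \<or> card {j. j < m \<and> \<not> P j} \<le> (R + 1) * N"
proof (rule ccontr)
  assume "\<not> ?thesis"
  then have big: "(R + 1) * N < card {j. j < m \<and> P j}" "(R + 1) * N < card {j. j < m \<and> \<not> P j}"
    by auto
  obtain i where i: "i + N \<le> m" "\<And>j. i \<le> j \<Longrightarrow> j < i + N \<Longrightarrow> P j"
    using long_run[OF assms(1) big(1)] by blast
  obtain k where k: "k + N \<le> m" "\<And>j. k \<le> j \<Longrightarrow> j < k + N \<Longrightarrow> \<not> P j"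
    using long_run[of m "\<lambda>j. \<not> P j" R N] assms(2) big(2) by auto
  show False
  proof (cases "i \<le> k")
    case True
    then show False using many_crossings[of i N P k m] i k assms(3) by auto
  next
    case False
    then show False using many_crossings[of k N "\<lambda>j. \<not> P j" i m] i k assms(4) by auto
  qed
qed

section \<open>Permutations of a set labelled by words\<close>

text \<open>
  \<open>u\<close> and \<open>v\<close> agree up to the last \<open>L\<close> letters of \<open>u\<close>.  The quantification over prefixes is the
  form in which this is applied to the cuts: outside the words that are less than \<open>L\<close> letters longer
  than \<open>w\<close>, a step from \<open>u\<close> to \<open>v\<close> does not leave the words with prefix \<open>w\<close>.
\<close>

definition close_words :: "nat \<Rightarrow> 'b list \<Rightarrow> 'b list \<Rightarrow> bool" where
  "close_words L u v \<longleftrightarrow> (\<forall>w. prefix w u \<longrightarrow> length w + L \<le> length u \<longrightarrow> prefix w v)"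

lemma close_words_refl: "close_words 0 u u"
  by (simp add: close_words_def)

lemma close_words_mono: "close_words L u v \<Longrightarrow> L \<le> L' \<Longrightarrow> close_words L' u v"
  by (auto simp: close_words_def)

lemma close_words_trans:
  assumes uv: "close_words L u v" and vw: "close_words L' v w"
  shows "close_words (L + L') u w"
  unfolding close_words_def
proof (intro allI impI)
  fix p assume p: "prefix p u" "length p + (L + L') \<le> length u"
  have "prefix (take (length p + L') u) v"
    using uv p(2) by (auto simp: close_words_def take_is_prefix)
  then have "length p + L' \<le> length v" using p(2) by (auto dest: prefix_length_le)
  moreover have "prefix p v" using uv p unfolding close_words_def by auto
  ultimately show "prefix p w" using vw unfolding close_words_def by blast
qed

text \<open>
  The words over \<open>\<Sigma>\<close> form a rooted tree of bounded degree, and a labelling places \<open>X\<close> on its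
  vertices.  The cuts belong to the edges of the tree: above \<open>w\<close> lie the elements of \<open>X\<close> whose label
  has the prefix \<open>w\<close>.
\<close>

locale word_labelling =
  fixes X :: "'a set" and \<rho> :: "'a \<Rightarrow> 'b list" and \<Sigma> :: "'b set" and K :: nat
  assumes finite_alphabet: "finite \<Sigma>"
    and label: "\<And>x. x \<in> X \<Longrightarrow> set (\<rho> x) \<subseteq> \<Sigma>"
    and finite_fibre: "\<And>w. finite {x \<in> X. \<rho> x = w}"
    and card_fibre: "\<And>w. card {x \<in> X. \<rho> x = w} \<le> K"
begin

definition collar_bound :: "nat \<Rightarrow> nat" where
  "collar_bound L = card {u. set u \<subseteq> \<Sigma> \<and> length u \<le> L} * K"

text \<open>
  Only elements in the collar \<open>C w L\<close> can be taken out of the part above \<open>w\<close> by a step to an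
  element whose label agrees up to \<open>L\<close> letters.  The bound on its size is uniform in \<open>w\<close>.
\<close>

lemma collar:
  defines "C \<equiv> \<lambda>w L. {x \<in> X. prefix w (\<rho> x) \<and> length (\<rho> x) < length w + L}"
  shows "finite (C w L)" and "card (C w L) \<le> collar_bound L"
proof -
  let ?U = "{u. set u \<subseteq> \<Sigma> \<and> length u \<le> L}"
  have fin: "finite ?U" by (rule finite_lists_length_le[OF finite_alphabet])
  have sub: "C w L \<subseteq> (\<Union>u\<in>?U. {x \<in> X. \<rho> x = w @ u})"
    using label by (fastforce simp: C_def prefix_def)
  have finU: "finite (\<Union>u\<in>?U. {x \<in> X. \<rho> x = w @ u})"
    using fin finite_fibre by blast
  show "finite (C w L)" using sub finU by (rule finite_subset)
  have "card (C w L) \<le> card (\<Union>u\<in>?U. {x \<in> X. \<rho> x = w @ u})" by (rule card_mono[OF finU sub])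
  also have "\<dots> \<le> (\<Sum>u\<in>?U. card {x \<in> X. \<rho> x = w @ u})" by (rule card_UN_le[OF fin])
  also have "\<dots> \<le> card ?U * K" using sum_bounded_above[of ?U _ K] card_fibre by simp
  finally show "card (C w L) \<le> collar_bound L" by (simp add: collar_bound_def)
qed

definition displaces_within :: "nat \<Rightarrow> ('a \<Rightarrow> 'a) \<Rightarrow> bool" where
  "displaces_within L g \<longleftrightarrow>
     (\<forall>x\<in>X. close_words L (\<rho> x) (\<rho> (g x)) \<and> close_words L (\<rho> (g x)) (\<rho> x))"

text \<open>
  An exit is counted by its starting point, which lies in the collar, and an entry by its end point;
  here the symmetry of \<^const>\<open>displaces_within\<close> is used.
\<close>

lemma crossings_le_collar_bound:
  fixes s :: "nat \<Rightarrow> 'a"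
  assumes g: "displaces_within L g" and s: "inj_on s {..<m}" "s ` {..<m} \<subseteq> X"
    and step: "\<And>j. j + N < m \<Longrightarrow> s (j + N) = g (s j)"
  shows "card {j. j + N < m \<and> prefix w (\<rho> (s j)) \<and> \<not> prefix w (\<rho> (s (j + N)))} \<le> collar_bound L"
    and "card {j. j + N < m \<and> \<not> prefix w (\<rho> (s j)) \<and> prefix w (\<rho> (s (j + N)))} \<le> collar_bound L"
proof -
  let ?C = "{x \<in> X. prefix w (\<rho> x) \<and> length (\<rho> x) < length w + L}"
  have close: "close_words L (\<rho> (s j)) (\<rho> (s (j + N)))" "close_words L (\<rho> (s (j + N))) (\<rho> (s j))"
    if "j + N < m" for j
  proof -
    have "s j \<in> X" using s(2) that by auto
    then show "close_words L (\<rho> (s j)) (\<rho> (s (j + N)))" "close_words L (\<rho> (s (j + N))) (\<rho> (s j))"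
      using g step[OF that] by (simp_all add: displaces_within_def)
  qed
  have *: "card J \<le> collar_bound L" if "inj_on t J" "t ` J \<subseteq> ?C" for t :: "nat \<Rightarrow> 'a" and J
    using card_inj_on_le[OF that collar(1)] collar(2)[of w L] by linarith
  show "card {j. j + N < m \<and> prefix w (\<rho> (s j)) \<and> \<not> prefix w (\<rho> (s (j + N)))} \<le> collar_bound L"
  proof (rule *[of s])
    show "inj_on s {j. j + N < m \<and> prefix w (\<rho> (s j)) \<and> \<not> prefix w (\<rho> (s (j + N)))}"
      by (rule inj_on_subset[OF s(1)]) auto
    show "s ` {j. j + N < m \<and> prefix w (\<rho> (s j)) \<and> \<not> prefix w (\<rho> (s (j + N)))} \<subseteq> ?C"
      using close(1) s(2) by (force simp: close_words_def not_le[symmetric])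
  qed
  show "card {j. j + N < m \<and> \<not> prefix w (\<rho> (s j)) \<and> prefix w (\<rho> (s (j + N)))} \<le> collar_bound L"
  proof (rule *[of "\<lambda>j. s (j + N)"])
    show "inj_on (\<lambda>j. s (j + N)) {j. j + N < m \<and> \<not> prefix w (\<rho> (s j)) \<and> prefix w (\<rho> (s (j + N)))}"
    proof (rule inj_onI)
      fix i j
      assume "s (i + N) = s (j + N)"
        and "i \<in> {j. j + N < m \<and> \<not> prefix w (\<rho> (s j)) \<and> prefix w (\<rho> (s (j + N)))}"
        and "j \<in> {j. j + N < m \<and> \<not> prefix w (\<rho> (s j)) \<and> prefix w (\<rho> (s (j + N)))}"
      then show "i = j" using inj_onD[OF s(1), of "i + N" "j + N"] by simp
    qed
    show "(\<lambda>j. s (j + N)) ` {j. j + N < m \<and> \<not> prefix w (\<rho> (s j)) \<and> prefix w (\<rho> (s (j + N)))} \<subseteq> ?C"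
      using close(2) s(2) by (force simp: close_words_def not_le[symmetric])
  qed
qed

text \<open>
  Call \<open>w\<close> heavy if more than \<open>M\<close> of the points \<open>s j\<close> lie above \<open>w\<close>; then all but \<open>M\<close> of them
  do.  If there were more points than the bound, a heavy word could always be extended by a letter to
  a heavy word: otherwise the at most \<open>K\<close> points with label \<open>w\<close>, at most \<open>M\<close> points above each
  child of \<open>w\<close> and at most \<open>M\<close> points elsewhere would be all.  But no word longer than all the
  labels is heavy.
\<close>

lemma segment_bounded:
  fixes s :: "nat \<Rightarrow> 'a"
  assumes M: "\<And>w. card {j. j < m \<and> prefix w (\<rho> (s j))} \<le> M \<or>
                    card {j. j < m \<and> \<not> prefix w (\<rho> (s j))} \<le> M"
    and s: "inj_on s {..<m}" "s ` {..<m} \<subseteq> X"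
  shows "m \<le> K + card \<Sigma> * M + M"
proof (rule ccontr)
  assume big: "\<not> ?thesis"
  let ?A = "\<lambda>w. {j. j < m \<and> prefix w (\<rho> (s j))}"
  have heavy: "\<exists>w. length w = n \<and> M < card (?A w)" for n
  proof (induction n)
    case 0
    then show ?case using big by simp
  next
    case (Suc n)
    then obtain w where w: "length w = n" "M < card (?A w)" by blast
    have "\<exists>c\<in>\<Sigma>. M < card (?A (w @ [c]))"
    proof (rule ccontr)
      assume "\<not> ?thesis"
      then have light: "card (?A (w @ [c])) \<le> M" if "c \<in> \<Sigma>" for c using that by auto
      have fin: "finite (?A u)" for u by (rule finite_subset[of _ "{..<m}"]) auto
      have "?A w \<subseteq> {j. j < m \<and> \<rho> (s j) = w} \<union> (\<Union>c\<in>\<Sigma>. ?A (w @ [c]))"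
      proof
        fix j assume "j \<in> ?A w"
        then obtain u where j: "j < m" "\<rho> (s j) = w @ u" by (auto simp: prefix_def)
        then have "set u \<subseteq> \<Sigma>" using label[of "s j"] s(2) by auto
        then show "j \<in> {j. j < m \<and> \<rho> (s j) = w} \<union> (\<Union>c\<in>\<Sigma>. ?A (w @ [c]))"
          using j by (cases u) (auto simp: prefix_def)
      qed
      then have "card (?A w) \<le> card ({j. j < m \<and> \<rho> (s j) = w} \<union> (\<Union>c\<in>\<Sigma>. ?A (w @ [c])))"
        using fin finite_alphabet by (intro card_mono) auto
      also have "\<dots> \<le> card {j. j < m \<and> \<rho> (s j) = w} + card (\<Union>c\<in>\<Sigma>. ?A (w @ [c]))"
        by (rule card_Un_le)
      also have "card {j. j < m \<and> \<rho> (s j) = w} \<le> card {x \<in> X. \<rho> x = w}"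
        using s finite_fibre by (intro card_inj_on_le[of s]) (auto simp: inj_on_def)
      also have "\<dots> \<le> K" by (rule card_fibre)
      also have "card (\<Union>c\<in>\<Sigma>. ?A (w @ [c])) \<le> (\<Sum>c\<in>\<Sigma>. card (?A (w @ [c])))"
        by (rule card_UN_le[OF finite_alphabet])
      also have "\<dots> \<le> card \<Sigma> * M"
        using sum_bounded_above[of \<Sigma> "\<lambda>c. card (?A (w @ [c]))" M] light by simp
      finally have "card (?A w) \<le> K + card \<Sigma> * M" by simp
      moreover have "card {j. j < m \<and> \<not> prefix w (\<rho> (s j))} \<le> M" using M[of w] w(2) by simp
      moreover have "card (?A w) + card {j. j < m \<and> \<not> prefix w (\<rho> (s j))} = m"
      proof -
        have "?A w \<union> {j. j < m \<and> \<not> prefix w (\<rho> (s j))} = {..<m}" by auto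
        moreover have "card (?A w \<union> {j. j < m \<and> \<not> prefix w (\<rho> (s j))}) =
            card (?A w) + card {j. j < m \<and> \<not> prefix w (\<rho> (s j))}"
          by (rule card_Un_disjoint) auto
        ultimately show ?thesis by simp
      qed
      ultimately show False using big by simp
    qed
    then show ?case using w(1) by force
  qed
  obtain w where w: "length w = Suc (\<Sum>j<m. length (\<rho> (s j)))" "M < card (?A w)"
    using heavy by blast
  have "length (\<rho> (s j)) < length w" if "j < m" for j
    using member_le_sum[of j "{..<m}" "\<lambda>j. length (\<rho> (s j))"] that w(1) by simp
  then have "?A w = {}" using prefix_length_le not_le by blast
  then show False using w(2) by (metis card.empty not_less_zero)
qed

text \<open>
  Orbits are only considered through segments of pairwise distinct points, which makes the argument
  the same for finite and for infinite orbits.  The bound on segments is uniform, so that its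
  factorial is a common exponent for all orbits.
\<close>

lemma root_has_finite_order:
  assumes inj: "inj_on h X" and maps: "h ` X \<subseteq> X"
    and h: "displaces_within L h" and hN: "displaces_within L' (h ^^ N)"
    and N: "collar_bound L' < N"
  obtains k :: nat where "k > 0" and "\<And>x. x \<in> X \<Longrightarrow> (h ^^ k) x = x"
proof
  define M where "M = (collar_bound L + 1) * N"
  define b where "b = Suc (K + card \<Sigma> * M + M)"
  show "(fact b :: nat) > 0" by simp
  fix x assume x: "x \<in> X"
  have in_X: "(h ^^ i) y \<in> X" if "y \<in> X" for i y
    using that maps by (induction i) auto
  have inj_pow: "y = z" if "y \<in> X" "z \<in> X" "(h ^^ i) y = (h ^^ i) z" for i y z
    using that
  proof (induction i)
    case (Suc i)
    then show ?case using inj_onD[OF inj, of "(h ^^ i) y" "(h ^^ i) z"] in_X by simp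
  qed simp
  define s where "s = (\<lambda>i. (h ^^ i) x)"
  have sX: "s ` {..<b} \<subseteq> X" using in_X x by (auto simp: s_def)
  have "\<not> inj_on s {..<b}"
  proof
    assume sinj: "inj_on s {..<b}"
    have step: "s (j + i) = (h ^^ i) (s j)" for i j
      unfolding s_def by (simp add: funpow_add add.commute[of j])
    have step1: "s (j + 1) = h (s j)" for j using step[of j 1] by simp
    note c1 = crossings_le_collar_bound[OF h sinj sX step1, simplified]
    note cN = crossings_le_collar_bound[OF hN sinj sX step]
    have "b \<le> K + card \<Sigma> * M + M"
    proof (rule segment_bounded[OF _ sinj sX])
      fix w
      show "card {j. j < b \<and> prefix w (\<rho> (s j))} \<le> M \<or> card {j. j < b \<and> \<not> prefix w (\<rho> (s j))} \<le> M"
        unfolding M_def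
        by (rule lopsided_cut[OF c1]) (use le_less_trans[OF cN(1) N] le_less_trans[OF cN(2) N] in auto)
    qed
    then show False by (simp add: b_def)
  qed
  then obtain i j where ij: "i < j" "j < b" "s i = s j"
    unfolding inj_on_def by (metis lessThan_iff linorder_neq_iff)
  have "(h ^^ i) ((h ^^ (j - i)) x) = (h ^^ i) x"
    using ij by (simp add: s_def funpow_add[symmetric, THEN fun_cong, unfolded comp_def])
  then have per: "(h ^^ (j - i)) x = x" using inj_pow[of "(h ^^ (j - i)) x" x i] in_X x by simp
  have "(j - i) dvd fact b" using ij by (intro dvd_fact) auto
  then obtain q where q: "fact b = (j - i) * q" by (elim dvdE)
  have "(((h ^^ (j - i)) ^^ q) x) = x" using per by (induction q) auto
  then show "(h ^^ fact b) x = x" unfolding q by (simp add: funpow_mult mult.commute)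
qed

end

section \<open>Reduced words of products in a free group\<close>

lemma reduced_snoc:
  "reduced (u @ [a]) \<longleftrightarrow> reduced u \<and> (u = [] \<or> \<not> (fst (last u) = fst a \<and> snd (last u) \<noteq> snd a))"
  by (induction u rule: reduced.induct) auto

locale free_group_with_basis = group G for G (structure) +
  fixes B
  assumes basis: "free_basis G B"
begin

definition nf :: "'a \<Rightarrow> 'a word" where
  "nf = inv_into (reduced_words B) (word_val G (\<lambda>b. b))"

lemma basis_closed: "(\<lambda>b. b) \<in> B \<rightarrow> carrier G"
  using basis by (auto simp: free_basis_def)

lemma nf_reduced: "g \<in> carrier G \<Longrightarrow> nf g \<in> reduced_words B"
  and word_val_nf: "g \<in> carrier G \<Longrightarrow> word_val G (\<lambda>b. b) (nf g) = g"
  using basis unfolding nf_def free_basis_def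
  by (auto simp: bij_betw_def inv_into_into f_inv_into_f)

lemma nf_eqI: "w \<in> reduced_words B \<Longrightarrow> word_val G (\<lambda>b. b) w = g \<Longrightarrow> nf g = w"
  using basis unfolding nf_def free_basis_def by (auto simp: bij_betw_def)

lemma nf_mult_letter:
  assumes g: "g \<in> carrier G" and a: "fst a \<in> B"
  shows "nf (g \<otimes> letter_val G (\<lambda>b. b) a) = nf g @ [a] \<or>
         nf (g \<otimes> letter_val G (\<lambda>b. b) a) = butlast (nf g)"
proof (cases "reduced (nf g @ [a])")
  case True
  have l: "fst ` set (nf g) \<subseteq> B" using nf_reduced[OF g] by (simp add: reduced_words_def)
  have "word_val G (\<lambda>b. b) (nf g @ [a]) = g \<otimes> letter_val G (\<lambda>b. b) a"
    using word_val_append[OF basis_closed l, of "[a]"] a word_val_nf[OF g]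
      letter_val_closed[OF basis_closed a] by simp
  moreover have "nf g @ [a] \<in> reduced_words B" using True a l by (simp add: reduced_words_def)
  ultimately show ?thesis using nf_eqI by blast
next
  case False
  have r: "reduced (nf g)" and l: "fst ` set (nf g) \<subseteq> B"
    using nf_reduced[OF g] by (simp_all add: reduced_words_def)
  from False r have ne: "nf g \<noteq> []" and c: "fst (last (nf g)) = fst a" "snd (last (nf g)) \<noteq> snd a"
    by (auto simp: reduced_snoc)
  define u where "u = butlast (nf g)"
  define y where "y = last (nf g)"
  have uy: "nf g = u @ [y]" using ne by (simp add: u_def y_def)
  have lu: "fst ` set u \<subseteq> B" "fst y \<in> B" using l uy by auto
  let ?v = "word_val G (\<lambda>b. b) u"
  have v: "?v \<in> carrier G" by (rule word_val_closed[OF basis_closed lu(1)])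
  have aG: "fst a \<in> carrier G" using a basis_closed by auto
  have "g = ?v \<otimes> letter_val G (\<lambda>b. b) y"
    using word_val_append[OF basis_closed lu(1), of "[y]"] lu(2) word_val_nf[OF g] uy
      letter_val_closed[OF basis_closed lu(2)] by simp
  then have "g \<otimes> letter_val G (\<lambda>b. b) a = ?v"
    using c v aG unfolding y_def[symmetric] by (auto simp: letter_val_def m_assoc)
  moreover have "u \<in> reduced_words B" using r lu uy by (simp add: reduced_words_def reduced_snoc)
  ultimately show ?thesis using nf_eqI u_def by metis
qed

text \<open>
  Multiplication by \<open>p\<close> on the right changes the reduced word at its end, one letter for each letter
  of \<open>p\<close>.  The statement about letters keeps track of the alphabet, since the basis may be infinite.
\<close>

lemma nf_mult:
  assumes g: "g \<in> carrier G" and p: "p \<in> carrier G"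
  shows "close_words (length (nf p)) (nf g) (nf (g \<otimes> p))"
    and "set (nf (g \<otimes> p)) \<subseteq> set (nf g) \<union> set (nf p)"
proof -
  have "close_words (length w) (nf g) (nf (g \<otimes> word_val G (\<lambda>b. b) w)) \<and>
        set (nf (g \<otimes> word_val G (\<lambda>b. b) w)) \<subseteq> set (nf g) \<union> set w"
    if "fst ` set w \<subseteq> B" for w
    using that
  proof (induction w rule: rev_induct)
    case Nil
    then show ?case using g by (simp add: close_words_refl)
  next
    case (snoc a w)
    let ?v = "word_val G (\<lambda>b. b) w" and ?a = "letter_val G (\<lambda>b. b) a"
    have w: "fst ` set w \<subseteq> B" and a: "fst a \<in> B" using snoc.prems by auto
    have v: "?v \<in> carrier G" and ac: "?a \<in> carrier G"
      by (rule word_val_closed[OF basis_closed w], rule letter_val_closed[OF basis_closed a])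
    have eq: "g \<otimes> word_val G (\<lambda>b. b) (w @ [a]) = (g \<otimes> ?v) \<otimes> ?a"
      using word_val_append[OF basis_closed w, of "[a]"] a v ac g by (simp add: m_assoc)
    have alt: "nf ((g \<otimes> ?v) \<otimes> ?a) = nf (g \<otimes> ?v) @ [a] \<or>
               nf ((g \<otimes> ?v) \<otimes> ?a) = butlast (nf (g \<otimes> ?v))"
      using g v a by (intro nf_mult_letter) auto
    then have "close_words 1 (nf (g \<otimes> ?v)) (nf ((g \<otimes> ?v) \<otimes> ?a))"
    proof
      assume "nf ((g \<otimes> ?v) \<otimes> ?a) = butlast (nf (g \<otimes> ?v))"
      then show ?thesis
        by (auto simp: close_words_def prefix_def butlast_append)
    qed (auto simp: close_words_def prefix_def)
    with snoc.IH[OF w] have "close_words (length w + 1) (nf g) (nf ((g \<otimes> ?v) \<otimes> ?a))"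
      by (blast intro: close_words_trans)
    moreover have "set (nf ((g \<otimes> ?v) \<otimes> ?a)) \<subseteq> set (nf g) \<union> set (w @ [a])"
      using alt snoc.IH[OF w] in_set_butlastD[of _ "nf (g \<otimes> ?v)"] by fastforce
    ultimately show ?case by (simp add: eq)
  qed
  from this[of "nf p"] nf_reduced[OF p] word_val_nf[OF p]
  show "close_words (length (nf p)) (nf g) (nf (g \<otimes> p))"
    and "set (nf (g \<otimes> p)) \<subseteq> set (nf g) \<union> set (nf p)"
    by (auto simp: reduced_words_def)
qed

end

section \<open>Labelling a virtually free group\<close>

text \<open>
  With \<open>\<tau>\<close> a choice of representatives of the right cosets of the free subgroup \<open>F\<close>, write
  \<open>x = f x \<cdot> \<tau> (F x)\<close>.  The map \<open>f\<close> into \<open>F\<close> commutes with left multiplication by \<open>F\<close>, so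
  multiplying \<open>x\<close> by a generator on the right multiplies \<open>f x\<close> on the right by one of finitely many
  elements of \<open>F\<close>, the set \<open>\<Phi>\<close> below.  As in Schreier's lemma, walking from \<open>\<one>\<close> along the Cayley
  graph shows that the letters of \<open>f \<one>\<close> and \<open>\<Phi>\<close> suffice for all labels.
\<close>

lemma virtually_free_labelling:
  assumes H: "group H" and S: "finite S" "S \<subseteq> carrier H" "generate H S = carrier H"
    and vf: "virtually_free H"
  obtains \<rho> :: "'a \<Rightarrow> 'a word" and \<Sigma> K L
  where "word_labelling (carrier H) \<rho> \<Sigma> K"
    and "\<And>x y. (x, y) \<in> cayley_edges H S \<Longrightarrow> close_words L (\<rho> x) (\<rho> y)"
proof -
  interpret group H by fact
  obtain F B where F: "subgroup F H" and fin: "finite (rcosets\<^bsub>H\<^esub> F)"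
    and grp: "group (H\<lparr>carrier := F\<rparr>)" and B: "free_basis (H\<lparr>carrier := F\<rparr>) B"
    using vf by (auto simp: virtually_free_def free_group_def)
  interpret F: free_group_with_basis "H\<lparr>carrier := F\<rparr>" B
    using grp B by (simp add: free_group_with_basis_def free_group_with_basis_axioms_def)
  have FH: "g \<in> carrier H" if "g \<in> F" for g using subgroup.mem_carrier[OF F that] .
  define \<tau> where "\<tau> c = (SOME t. t \<in> c)" for c :: "'a set"
  define f where "f x = x \<otimes>\<^bsub>H\<^esub> inv\<^bsub>H\<^esub> \<tau> (F #>\<^bsub>H\<^esub> x)" for x
  have coset: "F #>\<^bsub>H\<^esub> x \<in> rcosets\<^bsub>H\<^esub> F" if "x \<in> carrier H" for x
    using that by (auto simp: RCOSETS_def)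
  have \<tau>: "\<tau> (F #>\<^bsub>H\<^esub> x) \<in> F #>\<^bsub>H\<^esub> x" if "x \<in> carrier H" for x
    unfolding \<tau>_def using rcos_self[OF that F] by (rule someI)
  have \<tau>H: "\<tau> (F #>\<^bsub>H\<^esub> x) \<in> carrier H" if "x \<in> carrier H" for x
    using \<tau>[OF that] that F by (meson r_coset_subset_G subgroup.subset subsetD)
  have fF: "f x \<in> F" if x: "x \<in> carrier H" for x
  proof -
    obtain g where g: "g \<in> F" "\<tau> (F #>\<^bsub>H\<^esub> x) = g \<otimes>\<^bsub>H\<^esub> x" using \<tau>[OF x] by (auto simp: r_coset_def)
    then have "f x = inv\<^bsub>H\<^esub> g" using x FH[OF g(1)] by (simp add: f_def inv_mult_group m_assoc[symmetric])
    then show ?thesis using g(1) subgroup.m_inv_closed[OF F] by simp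
  qed
  have split: "x = f x \<otimes>\<^bsub>H\<^esub> \<tau> (F #>\<^bsub>H\<^esub> x)" if "x \<in> carrier H" for x
    using that \<tau>H[OF that] by (simp add: f_def m_assoc)
  have f_equivariant: "f (g \<otimes>\<^bsub>H\<^esub> x) = g \<otimes>\<^bsub>H\<^esub> f x" if g: "g \<in> F" and x: "x \<in> carrier H" for g x
  proof -
    have "F #>\<^bsub>H\<^esub> (g \<otimes>\<^bsub>H\<^esub> x) = F #>\<^bsub>H\<^esub> x"
      using coset_mult_assoc[OF subgroup.subset[OF F] FH[OF g] x] coset_join2[OF FH[OF g] F g] by simp
    then show ?thesis using FH[OF g] x \<tau>H[OF x] by (simp add: f_def m_assoc)
  qed
  define \<rho> where "\<rho> x = F.nf (f x)" for x
  define \<Phi> where "\<Phi> = (\<lambda>(c, a). f (\<tau> c \<otimes>\<^bsub>H\<^esub> a)) ` ((rcosets\<^bsub>H\<^esub> F) \<times> (S \<union> m_inv H ` S))"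
  have fin\<Phi>: "finite \<Phi>" using fin S(1) by (simp add: \<Phi>_def)
  have edge: "\<exists>p\<in>\<Phi>. p \<in> F \<and> f y = f x \<otimes>\<^bsub>H\<^esub> p" if e: "(x, y) \<in> cayley_edges H S" for x y
  proof -
    have x: "x \<in> carrier H" using e by (auto simp: cayley_edges_def)
    have "\<exists>a \<in> S \<union> m_inv H ` S. y = x \<otimes>\<^bsub>H\<^esub> a"
    proof -
      obtain s where s: "s \<in> S" "y = x \<otimes>\<^bsub>H\<^esub> s \<or> x = y \<otimes>\<^bsub>H\<^esub> s" and y: "y \<in> carrier H"
        using e by (auto simp: cayley_edges_def)
      have sH: "s \<in> carrier H" using s S by auto
      from s(2) show ?thesis
      proof
        assume "x = y \<otimes>\<^bsub>H\<^esub> s"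
        then have "y = x \<otimes>\<^bsub>H\<^esub> inv\<^bsub>H\<^esub> s" using y sH by (simp add: m_assoc)
        then show ?thesis using s(1) by blast
      qed (use s(1) in blast)
    qed
    then obtain a where a: "a \<in> S \<union> m_inv H ` S" "y = x \<otimes>\<^bsub>H\<^esub> a" by blast
    have aH: "a \<in> carrier H" using a(1) S by auto
    let ?p = "f (\<tau> (F #>\<^bsub>H\<^esub> x) \<otimes>\<^bsub>H\<^esub> a)"
    have "y = f x \<otimes>\<^bsub>H\<^esub> (\<tau> (F #>\<^bsub>H\<^esub> x) \<otimes>\<^bsub>H\<^esub> a)"
      using split[OF x] a(2) \<tau>H[OF x] aH FH[OF fF[OF x]] by (simp add: m_assoc[symmetric])
    then have "f y = f x \<otimes>\<^bsub>H\<^esub> ?p" using f_equivariant[OF fF[OF x]] \<tau>H[OF x] aH by simp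
    moreover have "?p \<in> \<Phi>" using coset[OF x] a(1) by (force simp: \<Phi>_def)
    moreover have "?p \<in> F" using fF \<tau>H[OF x] aH by simp
    ultimately show ?thesis by blast
  qed
  define L where "L = (\<Sum>p\<in>\<Phi>. length (F.nf p))"
  define \<Sigma> where "\<Sigma> = set (\<rho> \<one>\<^bsub>H\<^esub>) \<union> (\<Union>p\<in>\<Phi>. set (F.nf p))"
  show thesis
  proof
    show "close_words L (\<rho> x) (\<rho> y)" if e: "(x, y) \<in> cayley_edges H S" for x y
    proof -
      obtain p where p: "p \<in> \<Phi>" "p \<in> F" "f y = f x \<otimes>\<^bsub>H\<^esub> p" using edge[OF e] by blast
      have x: "x \<in> carrier H" using e by (auto simp: cayley_edges_def)
      have "close_words (length (F.nf p)) (\<rho> x) (\<rho> y)"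
        using F.nf_mult(1)[of "f x" p] fF[OF x] p by (simp add: \<rho>_def)
      moreover have "length (F.nf p) \<le> L" unfolding L_def using p(1) fin\<Phi> by (intro member_le_sum) auto
      ultimately show ?thesis by (rule close_words_mono)
    qed
    show "word_labelling (carrier H) \<rho> \<Sigma> (card (rcosets\<^bsub>H\<^esub> F))"
    proof
      show "finite \<Sigma>" using fin\<Phi> by (simp add: \<Sigma>_def)
      show "set (\<rho> x) \<subseteq> \<Sigma>" if x: "x \<in> carrier H" for x
      proof -
        obtain n where "(\<one>\<^bsub>H\<^esub>, x) \<in> cayley_edges H S ^^ n"
          using cayley_connected[OF S(2,3) one_closed x] by blast
        then show ?thesis
        proof (induction n arbitrary: x)
          case 0
          then show ?case by (simp add: \<Sigma>_def)
        next
          case (Suc n)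
          then obtain z where z: "(\<one>\<^bsub>H\<^esub>, z) \<in> cayley_edges H S ^^ n" "(z, x) \<in> cayley_edges H S"
            by auto
          obtain p where p: "p \<in> \<Phi>" "p \<in> F" "f x = f z \<otimes>\<^bsub>H\<^esub> p" using edge[OF z(2)] by blast
          have "z \<in> carrier H" using z(2) by (auto simp: cayley_edges_def)
          then have "set (\<rho> x) \<subseteq> set (\<rho> z) \<union> set (F.nf p)"
            using F.nf_mult(2)[of "f z" p] fF p by (simp add: \<rho>_def)
          then show ?case using Suc.IH[OF z(1)] p(1) by (auto simp: \<Sigma>_def)
        qed
      qed
      have fibre: "{x \<in> carrier H. \<rho> x = w} \<subseteq>
          (\<lambda>c. word_val (H\<lparr>carrier := F\<rparr>) (\<lambda>b. b) w \<otimes>\<^bsub>H\<^esub> \<tau> c) ` (rcosets\<^bsub>H\<^esub> F)" for w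
      proof
        fix x assume "x \<in> {x \<in> carrier H. \<rho> x = w}"
        then have x: "x \<in> carrier H" and w: "F.nf (f x) = w" by (auto simp: \<rho>_def)
        have "word_val (H\<lparr>carrier := F\<rparr>) (\<lambda>b. b) w = f x"
          using F.word_val_nf[of "f x"] fF[OF x] w by simp
        then show "x \<in> (\<lambda>c. word_val (H\<lparr>carrier := F\<rparr>) (\<lambda>b. b) w \<otimes>\<^bsub>H\<^esub> \<tau> c) ` (rcosets\<^bsub>H\<^esub> F)"
          using split[OF x] coset[OF x] by (intro image_eqI[of _ _ "F #>\<^bsub>H\<^esub> x"]) auto
      qed
      show "finite {x \<in> carrier H. \<rho> x = w}" for w
        using fibre by (rule finite_subset) (use fin in simp)
      show "card {x \<in> carrier H. \<rho> x = w} \<le> card (rcosets\<^bsub>H\<^esub> F)" for w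
        using surj_card_le[OF fin fibre] .
    qed
  qed
qed

section \<open>No dyadic group of bounded displacement permutations\<close>

lemma (in group) displaces_within_bd_perm:
  assumes S: "S \<subseteq> carrier G" "generate G S = carrier G"
    and lab: "word_labelling (carrier G) \<rho> \<Sigma> K"
    and edge: "\<And>x y. (x, y) \<in> cayley_edges G S \<Longrightarrow> close_words L (\<rho> x) (\<rho> y)"
    and g: "g \<in> bd_perms (carrier G) (cayley_dist G S)"
  obtains D where "word_labelling.displaces_within (carrier G) \<rho> D g"
proof -
  obtain r :: nat where gB: "g \<in> Bij (carrier G)"
    and r: "\<And>x. x \<in> carrier G \<Longrightarrow> cayley_dist G S x (g x) \<le> real r"
    using g by (auto simp: bd_perms_def)
  have path: "close_words (n * L) (\<rho> x) (\<rho> y)" if "(x, y) \<in> cayley_edges G S ^^ n" for n x y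
    using that
  proof (induction n arbitrary: y)
    case 0
    then show ?case by (simp add: close_words_refl)
  next
    case (Suc n)
    then obtain z where "(x, z) \<in> cayley_edges G S ^^ n" "(z, y) \<in> cayley_edges G S" by auto
    then have "close_words (n * L + L) (\<rho> x) (\<rho> y)"
      using Suc.IH edge by (blast intro: close_words_trans)
    then show ?case by (simp add: add.commute)
  qed
  have "close_words (r * L) (\<rho> x) (\<rho> (g x)) \<and> close_words (r * L) (\<rho> (g x)) (\<rho> x)"
    if x: "x \<in> carrier G" for x
  proof -
    have gx: "g x \<in> carrier G" using Bij_imp_funcset[OF gB] x by auto
    let ?n = "LEAST n. (x, g x) \<in> cayley_edges G S ^^ n"
    have n: "(x, g x) \<in> cayley_edges G S ^^ ?n"
      using cayley_connected[OF S x gx] by (rule LeastI_ex)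
    have "?n \<le> r" using r[OF x] by (simp add: cayley_dist_def)
    then have "?n * L \<le> r * L" by simp
    then show ?thesis using path[OF n] path[OF cayley_path_sym[OF n]] by (blast intro: close_words_mono)
  qed
  then show thesis using that[of "r * L"] by (simp add: word_labelling.displaces_within_def[OF lab])
qed

theorem corollary2:
  fixes H :: "('a, 'c) monoid_scheme" and S :: "'a set"
  assumes "group H"
    and "finite S" and "S \<subseteq> carrier H" and "generate H S = carrier H"
    and "virtually_free H"
  shows "\<not> (\<exists>K. subgroup K (Bd (carrier H) (cayley_dist H S)) \<and>
               dyadic_group \<cong> (Bd (carrier H) (cayley_dist H S))\<lparr>carrier := K\<rparr>)"
proof (intro notI, elim exE conjE)
  let ?X = "carrier H" and ?d = "cayley_dist H S"
  fix K
  assume K: "subgroup K (Bd ?X ?d)" and iso: "dyadic_group \<cong> (Bd ?X ?d)\<lparr>carrier := K\<rparr>"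
  interpret group H by fact
  obtain f where f: "f \<in> iso dyadic_group ((Bd ?X ?d)\<lparr>carrier := K\<rparr>)"
    using iso by (auto simp: is_iso_def)
  let ?D = "carrier dyadic_group"
  have dyadic: "of_nat k / 2 ^ n \<in> ?D" for k n :: nat
    unfolding dyadic_group_def by (auto intro!: exI[of _ "int k"])
  have fbd: "f a \<in> bd_perms ?X ?d" if "a \<in> ?D" for a
    using f that subgroup.subset[OF K] by (auto simp: iso_def hom_def Bd_def)
  then have fB: "f a \<in> Bij ?X" if "a \<in> ?D" for a using that by (auto simp: bd_perms_def)
  have fX: "f a x \<in> ?X" if "a \<in> ?D" "x \<in> ?X" for a x
    using Bij_imp_funcset[OF fB[OF that(1)]] that(2) by auto
  have f_add: "f (a + b) x = f b (f a x)" if "a \<in> ?D" "b \<in> ?D" "x \<in> ?X" for a b x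
  proof -
    have "f (a \<otimes>\<^bsub>dyadic_group\<^esub> b) = f a \<otimes>\<^bsub>(Bd ?X ?d)\<lparr>carrier := K\<rparr>\<^esub> f b"
      using f that by (auto simp: iso_def hom_def)
    then have "f (a + b) = compose ?X (f b) (f a)"
      using fB that by (simp add: Bd_def dyadic_group_def)
    then show ?thesis using that by (simp add: compose_eq)
  qed
  have f_inj: "inj_on (f a) ?X" if "a \<in> ?D" for a
    using fB[OF that] by (auto simp: Bij_def bij_betw_def)
  have zero: "0 \<in> ?D" using dyadic[of 0 0] by simp
  have f0: "f 0 x = x" if x: "x \<in> ?X" for x
    using f_add[OF zero zero x] inj_onD[OF f_inj[OF zero], of "f 0 x" x] fX[OF zero x] x by simp
  have f_mult: "f (of_nat k / 2 ^ n) x = (f (1 / 2 ^ n) ^^ k) x" if x: "x \<in> ?X" for k n x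
  proof (induction k)
    case 0
    then show ?case using f0[OF x] by simp
  next
    case (Suc k)
    have "of_nat (Suc k) / 2 ^ n = of_nat k / 2 ^ n + (1 / 2 ^ n :: rat)"
      by (simp add: add_divide_distrib)
    then show ?case using f_add[OF dyadic[of k n] dyadic[of 1 n] x] Suc by simp
  qed
  have "1 \<in> ?D" using dyadic[of 1 0] by simp
  obtain \<rho> \<Sigma> c L where lab: "word_labelling ?X (\<rho> :: 'a \<Rightarrow> 'a word) \<Sigma> c"
    and edge: "\<And>x y. (x, y) \<in> cayley_edges H S \<Longrightarrow> close_words L (\<rho> x) (\<rho> y)"
    using virtually_free_labelling[OF assms] by metis
  interpret W: word_labelling ?X \<rho> \<Sigma> c by fact
  obtain R where R: "W.displaces_within R (f 1)"
    using displaces_within_bd_perm[OF assms(3,4) lab edge fbd[OF \<open>1 \<in> ?D\<close>]] by blast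
  define n where "n = W.collar_bound R"
  define h where "h = f (1 / 2 ^ n)"
  have hD: "1 / 2 ^ n \<in> ?D" using dyadic[of 1 n] by simp
  obtain R' where R': "W.displaces_within R' h"
    using displaces_within_bd_perm[OF assms(3,4) lab edge fbd[OF hD]] unfolding h_def by blast
  have "(h ^^ (2 ^ n)) x = f 1 x" if "x \<in> ?X" for x
    using f_mult[OF that, of "2 ^ n" n] by (simp add: h_def)
  then have RN: "W.displaces_within R (h ^^ (2 ^ n))"
    using R by (simp add: W.displaces_within_def)
  \<comment> \<open>The root is chosen by the displacement of \<open>f 1\<close> alone; that of \<open>h\<close> may grow with \<open>n\<close>.\<close>
  have "W.collar_bound R < 2 ^ n" by (simp add: n_def)
  then obtain k :: nat where k: "k > 0" "\<And>x. x \<in> ?X \<Longrightarrow> (h ^^ k) x = x"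
    using W.root_has_finite_order[OF _ _ R' RN] f_inj[OF hD] fX[OF hD] unfolding h_def by blast
  have "f (of_nat k / 2 ^ n) = f 0"
  proof (rule extensionalityI)
    show "f (of_nat k / 2 ^ n) \<in> extensional ?X" "f 0 \<in> extensional ?X"
      using fB[OF dyadic] fB[OF zero] by (auto simp: Bij_def)
    show "f (of_nat k / 2 ^ n) x = f 0 x" if "x \<in> ?X" for x
      using f_mult[OF that, of k n] k(2)[OF that] f0[OF that] by (simp add: h_def)
  qed
  moreover have "inj_on f ?D" using f by (auto simp: iso_def bij_betw_def)
  ultimately have "of_nat k / 2 ^ n = (0 :: rat)" using dyadic zero by (auto dest: inj_onD)
  then show False using k(1) by simp
qed

end
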